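(* Consider the problem $\min_{\mathbf w\in\mathcal W}\{f(\mathbf w)=h(X\mathbf w)+\mathbf q^T\mathbf w\}$ under assumptions A1, A2, A3 (stated in the context), with optimal solution set $\mathcal W_c^\star$ and optimal value $f^\star$. Let $p_i\in(0,1)$ with $\sum_{i=1}^n p_i=1$, let $L_P=\max_{1\le i\le n} L_i/(np_i)$, and let $0<\eta<1/(4L_P)$. Let $\{\mathbf w_t^k\}$, $\{\tilde{\mathbf w}^k\}$ be generated by the VRPSG algorithm (described in the context) with step size $\eta$, inner loop length $m$, probabilities $p_i$ and starting point $\tilde{\mathbf w}^0\in\mathcal W$. Assume that $\{\mathbf w_t^k\}$ is bounded, i.e. there is a bounded convex set $B\subseteq\mathcal W$ that contains all iterates $\mathbf w_t^k$ ($k\ge1$, $0\le t\le m$) for every realization of the random indices. Let $\mathbf r^\star,s^\star$ be the constants with $X\mathbf w^\star=\mathbf r^\star$, $\mathbf q^T\mathbf w^\star=s^\star$ for all $\mathbf w^\star\in\mathcal W_c^\star$; let $M>0$ satisfy $f(\mathbf w)-f^\star\le M$ for all $\mathbf w\in B$; let $\mu>0$ be a strong convexity modulus of $h$ on some convex compact set $\mathcal U\subseteq\mathrm{dom}(h)$ containing $\mathbf r^\star$ and $X\mathbf w$ for all $\mathbf w\in B$; let $\theta>0$ be a Hoffman constant of $\mathcal W_c^\star$ (defined in the context); and set $$\beta=\frac{1}{\theta^2\left(\frac{1+2\|\nabla h(\mathbf r^\star)\|^2}{\mu}+M\right)}.$$ If $m$ is sufficiently large such that $$\rho=\frac{4L_P\eta(m+1)}{(1-4L_P\eta)m}+\frac{1}{\beta\eta(1-4L_P\eta)m}<1,$$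 then for every $k\ge1$ $$\mathbb E_{\mathcal F_m^k}\left[f(\tilde{\mathbf w}^k)-f^\star\right]\le\rho^k\left(f(\tilde{\mathbf w}^0)-f^\star\right),$$ where $\mathbb E_{\mathcal F_m^k}$ denotes expectation with respect to all random indices $i_1^1,\dots,i_m^1,\dots,i_1^k,\dots,i_m^k$ drawn in the first $k$ outer iterations.
   Context: Norms are Euclidean; $\Pi_S$ is Euclidean projection onto the closed convex set $S$. Here $X\in\mathbb R^{n\times d}$, $\mathbf q\in\mathbb R^d$, $h$ is a real-valued function on $\mathrm{dom}(h)\subseteq\mathbb R^n$, and $X\mathbf w\in\mathrm{dom}(h)$ for all $\mathbf w\in\mathbb R^d$, so $f$ is real-valued on $\mathbb R^d$. A1: $f=\frac1n\sum_{i=1}^n f_i$ with each $f_i:\mathbb R^d\to\mathbb R$ convex and differentiable; $\nabla f$ and $\nabla f_i$ are Lipschitz continuous on $\mathbb R^d$ with constants $L>0$ and $L_i>0$. A2: $\mathrm{dom}(h)$ is open and non-empty; $h$ is continuously differentiable on $\mathrm{dom}(h)$ and strongly convex on any convex compact subset of $\mathrm{dom}(h)$. ($h$ is strongly convex with modulus $\mu>0$ on $\mathcal U$ if $h(\mathbf a)\ge h(\mathbf b)+\nabla h(\mathbf b)^T(\mathbf a-\mathbf b)+\frac\mu2\|\mathbf a-\mathbf b\|^2$ for all $\mathbf a,\mathbf b\in\mathcal U$.) A3: $\mathcal W=\{\mathbf w\in\mathbb R^d:C\mathbf w\le\mathbf b\}$ for some $C\in\mathbb R^{l\times d}$, $\mathbf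 b\in\mathbb R^l$; the optimal solution set $\mathcal W_c^\star$ is non-empty. Under A1–A3 there are unique $\mathbf r^\star\in\mathbb R^n$, $s^\star\in\mathbb R$ with $X\mathbf w^\star=\mathbf r^\star$, $\mathbf q^T\mathbf w^\star=s^\star$ for all $\mathbf w^\star\in\mathcal W_c^\star$, and $\mathcal W_c^\star=\{\mathbf w:C\mathbf w\le\mathbf b,\ X\mathbf w=\mathbf r^\star,\ \mathbf q^T\mathbf w=s^\star\}$. Hoffman constant: $\theta>0$ is such that for every $\mathbf w\in\mathbb R^d$ there is $\mathbf w^\star\in\mathcal W_c^\star$ with $\|\mathbf w-\mathbf w^\star\|^2\le\theta^2\left(\|[C\mathbf w-\mathbf b]^+\|^2+\|X\mathbf w-\mathbf r^\star\|^2+(\mathbf q^T\mathbf w-s^\star)^2\right)$, where $[\cdot]^+$ is the projection onto the non-negative orthant (such $\theta$ exists by Hoffman's bound; an admissible value is the supremum of $\|(\mathbf u,\mathbf v)\|$ over $\mathbf u\ge0$, $\mathbf v$ with $\|C^T\mathbf u+A^T\mathbf v\|=1$ and such that the rows of $C$ and $A$ corresponding to nonzero entries of $\mathbf u$ and $\mathbf v$ are linearly independent, where $A$ is $X$ with the additional row $\mathbf q^T$). VRPSG algorithm: given $\tilde{\mathbf w}^0\in\mathcal W$, for $k=1,2,\dots$: set $\tilde{\boldsymbol\xi}^{k-1}=\nabla f(\tilde{\mathbf w}^{k-1})$ and $\mathbf w_0^k=\tilde{\mathbf w}^{k-1}$; for $t=1,\dots,m$: draw $i_t^k\in\{1,\dots,n\}$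 independently of the past with $\Pr(i_t^k=i)=p_i$, set $\mathbf v_t^k=\left(\nabla f_{i_t^k}(\mathbf w_{t-1}^k)-\nabla f_{i_t^k}(\tilde{\mathbf w}^{k-1})\right)/(np_{i_t^k})+\tilde{\boldsymbol\xi}^{k-1}$ and $\mathbf w_t^k=\Pi_{\mathcal W}(\mathbf w_{t-1}^k-\eta\mathbf v_t^k)$; finally set $\tilde{\mathbf w}^k=\frac1m\sum_{t=1}^m\mathbf w_t^k$. *)

theory Defs
  imports "HOL-Probability.Probability"
begin

text \<open>Vectors of \<open>real ^ 'k\<close> are ordered componentwise by the library, so \<open>C *v w \<le> b\<close> and
  \<open>0 \<le> u\<close> below are componentwise inequalities.\<close>

definition grad :: "('a::real_inner \<Rightarrow> real) \<Rightarrow> 'a \<Rightarrow> 'a" where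
  "grad f x = (THE g. GDERIV f x :> g)"

lemma grad_eqI:
  fixes f :: "'a::real_inner \<Rightarrow> real"
  assumes "GDERIV f x :> g"
  shows "grad f x = g"
proof -
  have "g' = g" if "GDERIV f x :> g'" for g'
  proof -
    have "(\<lambda>v. inner v g') = (\<lambda>v. inner v g)"
      using that assms unfolding gderiv_def by (rule has_derivative_unique)
    then have "\<forall>v. inner v g' = inner v g"
      by metis
    then show ?thesis
      by (simp add: vector_eq_ldot)
  qed
  with assms show ?thesis
    unfolding grad_def by blast
qed

definition continuously_diff_on :: "('a::real_inner \<Rightarrow> real) \<Rightarrow> 'a set \<Rightarrow> bool" where
  "continuously_diff_on f S \<longleftrightarrow> (\<forall>x\<in>S. f differentiable (at x)) \<and> continuous_on S (grad f)"

definition strongly_convex_on :: "real \<Rightarrow> 'a set \<Rightarrow> ('a::real_inner \<Rightarrow> real) \<Rightarrow> bool" where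
  "strongly_convex_on \<mu> U h \<longleftrightarrow> \<mu> > 0 \<and>
     (\<forall>a\<in>U. \<forall>b\<in>U. h a \<ge> h b + grad h b \<bullet> (a - b) + \<mu> / 2 * (norm (a - b))\<^sup>2)"

definition pos_part :: "real ^ 'l \<Rightarrow> real ^ 'l" where
  "pos_part u = closest_point {v. 0 \<le> v} u"

definition hoffman_constant ::
  "real \<Rightarrow> (real ^ 'd) set \<Rightarrow> real ^ 'd ^ 'l \<Rightarrow> real ^ 'l \<Rightarrow> real ^ 'd ^ 'n \<Rightarrow> real ^ 'n
    \<Rightarrow> real ^ 'd \<Rightarrow> real \<Rightarrow> bool" where
  "hoffman_constant \<theta> Wopt C b X r q s \<longleftrightarrow> \<theta> > 0 \<and>
     (\<forall>w. \<exists>wopt\<in>Wopt. (norm (w - wopt))\<^sup>2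
        \<le> \<theta>\<^sup>2 * ((norm (pos_part (C *v w - b)))\<^sup>2 + (norm (X *v w - r))\<^sup>2 + (q \<bullet> w - s)\<^sup>2))"

definition vrpsg_direction ::
  "(real ^ 'd \<Rightarrow> real) \<Rightarrow> ('n \<Rightarrow> real ^ 'd \<Rightarrow> real) \<Rightarrow> ('n::finite \<Rightarrow> real)
    \<Rightarrow> real ^ 'd \<Rightarrow> real ^ 'd \<Rightarrow> 'n \<Rightarrow> real ^ 'd" where
  "vrpsg_direction f fc p snap w i =
     (grad (fc i) w - grad (fc i) snap) /\<^sub>R (of_nat CARD('n) * p i) + grad f snap"

text \<open>\<open>vrpsg_inner\<close> is one inner loop: \<open>snap\<close> is the reference point of the current outer
  iteration and \<open>j t\<close> is the index drawn in inner step \<open>t \<ge> 1\<close>.\<close>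

primrec vrpsg_inner ::
  "(real ^ 'd \<Rightarrow> real) \<Rightarrow> ('n \<Rightarrow> real ^ 'd \<Rightarrow> real) \<Rightarrow> (real ^ 'd) set \<Rightarrow> ('n::finite \<Rightarrow> real) \<Rightarrow> real
    \<Rightarrow> real ^ 'd \<Rightarrow> (nat \<Rightarrow> 'n) \<Rightarrow> nat \<Rightarrow> real ^ 'd" where
  "vrpsg_inner f fc W p \<eta> snap j 0 = snap"
| "vrpsg_inner f fc W p \<eta> snap j (Suc t) =
     (let w = vrpsg_inner f fc W p \<eta> snap j t
      in closest_point W (w - \<eta> *\<^sub>R vrpsg_direction f fc p snap w (j (Suc t))))"

text \<open>Here \<open>j k t\<close> is the index drawn in inner step \<open>t\<close> of outer iteration \<open>k\<close>, both counted
  from 1.\<close>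

primrec vrpsg_outer ::
  "(real ^ 'd \<Rightarrow> real) \<Rightarrow> ('n \<Rightarrow> real ^ 'd \<Rightarrow> real) \<Rightarrow> (real ^ 'd) set \<Rightarrow> ('n::finite \<Rightarrow> real) \<Rightarrow> real
    \<Rightarrow> nat \<Rightarrow> real ^ 'd \<Rightarrow> (nat \<Rightarrow> nat \<Rightarrow> 'n) \<Rightarrow> nat \<Rightarrow> real ^ 'd" where
  "vrpsg_outer f fc W p \<eta> m w0 j 0 = w0"
| "vrpsg_outer f fc W p \<eta> m w0 j (Suc k) =
     (\<Sum>t = 1..m. vrpsg_inner f fc W p \<eta> (vrpsg_outer f fc W p \<eta> m w0 j k) (j (Suc k)) t)
       /\<^sub>R of_nat m"

text \<open>The iterate with outer index \<open>k \<ge> 1\<close> and inner index \<open>t\<close>; the value at \<open>k = 0\<close> is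
  irrelevant.\<close>

definition vrpsg_iterate ::
  "(real ^ 'd \<Rightarrow> real) \<Rightarrow> ('n \<Rightarrow> real ^ 'd \<Rightarrow> real) \<Rightarrow> (real ^ 'd) set \<Rightarrow> ('n::finite \<Rightarrow> real) \<Rightarrow> real
    \<Rightarrow> nat \<Rightarrow> real ^ 'd \<Rightarrow> (nat \<Rightarrow> nat \<Rightarrow> 'n) \<Rightarrow> nat \<Rightarrow> nat \<Rightarrow> real ^ 'd" where
  "vrpsg_iterate f fc W p \<eta> m w0 j k t =
     vrpsg_inner f fc W p \<eta> (vrpsg_outer f fc W p \<eta> m w0 j (k - 1)) (j k) t"

text \<open>The indices \<open>J k t\<close> (\<open>k \<ge> 1\<close>, \<open>1 \<le> t \<le> m\<close>) are random variables on the probability space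
  \<open>P\<close>. Each one being independent of all earlier ones is the same as mutual independence of the
  family.\<close>

definition random_indices ::
  "'w measure \<Rightarrow> ('n \<Rightarrow> real) \<Rightarrow> nat \<Rightarrow> (nat \<Rightarrow> nat \<Rightarrow> 'w \<Rightarrow> 'n) \<Rightarrow> bool" where
  "random_indices P p m J \<longleftrightarrow> prob_space P \<and>
     prob_space.indep_vars P (\<lambda>_. count_space UNIV) (\<lambda>(k, t). J k t) ({1..} \<times> {1..m}) \<and>
     (\<forall>k\<ge>1. \<forall>t\<in>{1..m}. \<forall>i. measure P {\<omega> \<in> space P. J k t \<omega> = i} = p i)"

end

theory Submission
  imports Defs
begin

text \<open>Two facts drive the linear rate: the objective grows quadratically away from its minimizers,
  and the stochastic direction has a variance that vanishes as the iterates approach a minimizer.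

  Quadratic growth (\<open>hoffman_quadratic_growth\<close>). At a minimizer \<open>v\<close> the first-order condition makes
  \<open>grad h r \<bullet> (Xw - r) + (q \<bullet> w - s)\<close> non-negative on the polyhedron, so strong convexity of \<open>h\<close> bounds
  both this number and \<open>\<mu>/2 \<parallel>Xw - r\<parallel>\<^sup>2\<close> by the gap \<open>f w - f v\<close>. Hence the residuals \<open>Xw - r\<close> and
  \<open>q \<bullet> w - s\<close> are of the order of the square root of the gap, and the Hoffman bound turns them into
  \<open>\<parallel>w - v\<parallel>\<^sup>2 \<le> 2/\<beta> (f w - f v)\<close> for a suitable minimizer \<open>v\<close>, although \<open>f\<close> itself need not be
  strongly convex.

  Variance reduction (\<open>direction_variance\<close>). The direction is an unbiased estimate of \<open>grad f w\<close>.
  For a smooth convex function a squared gradient difference is at most \<open>2L\<close> times the Bregman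
  divergence; comparing both \<open>w\<close> and the reference point \<open>w'\<close> with a minimizer bounds the variance
  by \<open>4L\<^sub>P\<close> times the sum of their gaps. Inserted into the standard inequality for a projected
  gradient step from \<open>w\<close> to \<open>w\<^sub>+\<close> this gives, for every minimizer \<open>v\<close> and \<open>\<eta> L\<^sub>P \<le> 1\<close>,
  \<open>E \<parallel>w\<^sub>+ - v\<parallel>\<^sup>2 + 2\<eta> E (f w\<^sub>+ - f v) \<le> \<parallel>w - v\<parallel>\<^sup>2 + 8\<eta>\<^sup>2 L\<^sub>P ((f w - f v) + (f w' - f v))\<close>
  (\<open>expected_projected_step\<close>).

  Summing over the inner loop telescopes the distances. The first distance is controlled by
  quadratic growth at the reference point, and Jensen's inequality passes from the mean of the gaps
  to the gap of the mean; solving for the latter yields the factor \<open>\<rho>\<close> per outer iteration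
  (\<open>outer_step_expectation\<close>).

  Expectations over the indices reduce to finite sums: a finite stretch of the algorithm takes
  finitely many values, and independence lets the next index be averaged out with the weights \<open>p\<close>
  (\<open>expectation_fresh_index\<close>).\<close>

section \<open>Gradients of convex and smooth functions\<close>

text \<open>By the Riesz representation, here given by the adjoint of the derivative at the scalar \<open>1\<close>.\<close>

lemma GDERIV_grad:
  fixes f :: "'a::euclidean_space \<Rightarrow> real"
  assumes "f differentiable (at x)"
  shows "GDERIV f x :> grad f x"
proof -
  from assms obtain f' where f': "(f has_derivative f') (at x)"
    unfolding differentiable_def by blast
  have "f' = (\<lambda>v. v \<bullet> adjoint f' 1)"
    using adjoint_works[OF has_derivative_linear[OF f'], of _ 1] by simp
  with f' have "GDERIV f x :> adjoint f' 1"
    unfolding gderiv_def by metis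
  then show ?thesis
    using grad_eqI by metis
qed

lemma grad_along_line:
  fixes f :: "'a::euclidean_space \<Rightarrow> real"
  assumes "f differentiable (at (x + t *\<^sub>R d))"
  shows "((\<lambda>t. f (x + t *\<^sub>R d)) has_real_derivative grad f (x + t *\<^sub>R d) \<bullet> d) (at t)"
proof -
  have "((\<lambda>t. x + t *\<^sub>R d) has_derivative (\<lambda>h. h *\<^sub>R d)) (at t)"
    by (auto intro!: derivative_eq_intros)
  moreover have "(f has_derivative (\<lambda>v. v \<bullet> grad f (x + t *\<^sub>R d))) (at (x + t *\<^sub>R d))"
    using GDERIV_grad[OF assms] unfolding gderiv_def .
  ultimately have "((\<lambda>t. f (x + t *\<^sub>R d)) has_derivative
      (\<lambda>h. h *\<^sub>R d \<bullet> grad f (x + t *\<^sub>R d))) (at t)"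
    by (rule has_derivative_compose)
  then show ?thesis
    by (simp add: has_field_derivative_def inner_commute mult.commute[of _ "_ \<bullet> _"])
qed

text \<open>Both the optimality condition on a convex set and the tangent-plane inequality are instances of
  this one-dimensional fact, applied along a segment.\<close>

lemma deriv_nonneg_at_left_minimum:
  fixes \<psi> :: "real \<Rightarrow> real"
  assumes "(\<psi> has_real_derivative l) (at 0)" and "\<And>t. 0 \<le> t \<Longrightarrow> t \<le> 1 \<Longrightarrow> \<psi> 0 \<le> \<psi> t"
  shows "0 \<le> l"
proof (rule ccontr)
  assume "\<not> 0 \<le> l"
  with DERIV_neg_dec_right[OF assms(1)] obtain e where e: "e > 0"
    "\<And>h. 0 < h \<Longrightarrow> h < e \<Longrightarrow> \<psi> h < \<psi> 0"
    by fastforce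
  have "\<psi> (min (e / 2) 1) < \<psi> 0"
    using e(1) by (intro e(2)) auto
  moreover have "\<psi> 0 \<le> \<psi> (min (e / 2) 1)"
    using e(1) by (intro assms(2)) auto
  ultimately show False
    by simp
qed

lemma grad_at_constrained_minimum:
  fixes f :: "'a::euclidean_space \<Rightarrow> real"
  assumes "convex W" "x \<in> W" "y \<in> W" and "\<And>z. z \<in> W \<Longrightarrow> f x \<le> f z"
    and "f differentiable (at x)"
  shows "0 \<le> grad f x \<bullet> (y - x)"
proof (rule deriv_nonneg_at_left_minimum)
  show "((\<lambda>t. f (x + t *\<^sub>R (y - x))) has_real_derivative grad f x \<bullet> (y - x)) (at 0)"
    using grad_along_line[of f x 0 "y - x"] assms(5) by simp
  fix t :: real
  assume "0 \<le> t" "t \<le> 1"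
  then have "x + t *\<^sub>R (y - x) \<in> W"
    using convexD_alt[OF assms(1-3), of t] by (simp add: algebra_simps)
  then show "f (x + 0 *\<^sub>R (y - x)) \<le> f (x + t *\<^sub>R (y - x))"
    using assms(4) by simp
qed

lemma convex_above_tangent_plane:
  fixes f :: "'a::euclidean_space \<Rightarrow> real"
  assumes "convex_on UNIV f" "f differentiable (at x)"
  shows "f x + grad f x \<bullet> (y - x) \<le> f y"
proof -
  have "0 \<le> (f y - f x) - grad f x \<bullet> (y - x)"
  proof (rule deriv_nonneg_at_left_minimum)
    \<comment> \<open>The chord minus the graph is non-negative on the segment and vanishes at its left end.\<close>
    have "((\<lambda>t. f (x + t *\<^sub>R (y - x))) has_real_derivative grad f x \<bullet> (y - x)) (at 0)"
      using grad_along_line[of f x 0 "y - x"] assms(2) by simp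
    then show "((\<lambda>t. (f x + t * (f y - f x)) - f (x + t *\<^sub>R (y - x)))
        has_real_derivative (f y - f x) - grad f x \<bullet> (y - x)) (at 0)"
      by (auto intro!: derivative_eq_intros)
    fix t :: real
    assume "0 \<le> t" "t \<le> 1"
    then have "f ((1 - t) *\<^sub>R x + t *\<^sub>R y) \<le> (1 - t) * f x + t * f y"
      using convex_onD[OF assms(1), of t x y] by simp
    then show "(f x + 0 * (f y - f x)) - f (x + 0 *\<^sub>R (y - x))
        \<le> (f x + t * (f y - f x)) - f (x + t *\<^sub>R (y - x))"
      by (simp add: algebra_simps)
  qed
  then show ?thesis
    by simp
qed

text \<open>The difference between \<open>f\<close> and the quadratic model decreases along the ray from \<open>x\<close> to \<open>y\<close>, since
  the slope of \<open>f\<close> deviates from its initial value by at most \<open>L\<close> times the distance travelled.\<close>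

lemma lipschitz_grad_quadratic_upper_bound:
  fixes f :: "'a::euclidean_space \<Rightarrow> real"
  assumes "\<And>x. f differentiable (at x)" and lip: "L-lipschitz_on UNIV (grad f)"
  shows "f y \<le> f x + grad f x \<bullet> (y - x) + L / 2 * (norm (y - x))\<^sup>2"
proof -
  define d where "d = y - x"
  define \<psi> where
    "\<psi> t = f (x + t *\<^sub>R d) - (t * (grad f x \<bullet> d) + L / 2 * t\<^sup>2 * (norm d)\<^sup>2)" for t
  have "\<psi> 1 \<le> \<psi> 0"
  proof (rule DERIV_nonpos_imp_nonincreasing[of 0 1 \<psi>])
    fix t :: real
    assume t: "0 \<le> t" "t \<le> 1"
    let ?l = "grad f (x + t *\<^sub>R d) \<bullet> d - (grad f x \<bullet> d + L * t * (norm d)\<^sup>2)"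
    have "(\<psi> has_real_derivative ?l) (at t)"
      unfolding \<psi>_def using grad_along_line[of f x t d] assms(1)
      by (auto intro!: derivative_eq_intros)
    moreover have "?l \<le> 0"
    proof -
      have "(grad f (x + t *\<^sub>R d) - grad f x) \<bullet> d \<le> norm (grad f (x + t *\<^sub>R d) - grad f x) * norm d"
        by (rule norm_cauchy_schwarz)
      also have "\<dots> \<le> (L * norm (t *\<^sub>R d)) * norm d"
        using lipschitz_onD[OF lip, of "x + t *\<^sub>R d" x]
        by (intro mult_right_mono) (auto simp: dist_norm)
      finally show "?l \<le> 0"
        using t by (simp add: inner_diff_left power2_eq_square mult.assoc)
    qed
    ultimately show "\<exists>l. (\<psi> has_real_derivative l) (at t) \<and> l \<le> 0"
      by blast
  qed simp
  then show ?thesis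
    by (simp add: \<psi>_def d_def)
qed

text \<open>A gradient step of length \<open>1/L\<close> on the Bregman divergence \<open>\<lambda>x. f x - f y - grad f y \<bullet> (x - y)\<close> lowers
  it by at least \<open>1/(2L)\<close> times its squared gradient, and the divergence cannot become negative.\<close>

lemma convex_lipschitz_grad_bregman_bound:
  fixes f :: "'a::euclidean_space \<Rightarrow> real"
  assumes cvx: "convex_on UNIV f" and diff: "\<And>x. f differentiable (at x)"
    and L: "L > 0" and lip: "L-lipschitz_on UNIV (grad f)"
  shows "(norm (grad f x - grad f y))\<^sup>2 \<le> 2 * L * (f x - f y - grad f y \<bullet> (x - y))"
proof -
  define g where "g = grad f x - grad f y"
  define z where "z = x - (1 / L) *\<^sub>R g"
  have "f y + grad f y \<bullet> (z - y) \<le> f z"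
    by (rule convex_above_tangent_plane[OF cvx diff])
  also have "\<dots> \<le> f x + grad f x \<bullet> (z - x) + L / 2 * (norm (z - x))\<^sup>2"
    by (rule lipschitz_grad_quadratic_upper_bound[OF diff lip])
  finally have "f y + grad f y \<bullet> (x - y) \<le> f x + g \<bullet> (z - x) + L / 2 * (norm (z - x))\<^sup>2"
    by (simp add: g_def inner_diff_left inner_diff_right)
  also have "g \<bullet> (z - x) = - (norm g)\<^sup>2 / L"
    by (simp add: z_def power2_norm_eq_inner)
  also have "L / 2 * (norm (z - x))\<^sup>2 = (norm g)\<^sup>2 / (2 * L)"
    using L by (simp add: z_def power_divide power2_eq_square)
  finally have "(norm g)\<^sup>2 / (2 * L) \<le> f x - f y - grad f y \<bullet> (x - y)"
    using L by (simp add: field_simps)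
  then show ?thesis
    using L by (simp add: g_def field_simps)
qed

section \<open>Quadratic growth of the objective\<close>

lemma convex_closed_polyhedron:
  fixes C :: "real ^ 'd ^ 'l"
  shows "convex {w. C *v w \<le> b}" "closed {w. C *v w \<le> b}"
proof -
  have "{w. C *v w \<le> b} = (\<Inter>i. {w. C $ i \<bullet> w \<le> b $ i})"
    by (auto simp: less_eq_vec_def matrix_vector_mul_component)
  then show "convex {w. C *v w \<le> b}" "closed {w. C *v w \<le> b}"
    by (auto intro!: convex_INT closed_INT simp: convex_halfspace_le closed_halfspace_le)
qed

lemma pos_part_eq_0:
  fixes u :: "real ^ 'l"
  assumes "u \<le> 0"
  shows "pos_part u = 0"
  unfolding pos_part_def
proof (rule closest_point_unique[symmetric])
  have "{v::real ^ 'l. 0 \<le> v} = {v. - mat 1 *v v \<le> 0}"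
    using matrix_vector_mult_diff_rdistrib[of 0 "mat 1 :: real ^ 'l ^ 'l"]
    by (auto simp: less_eq_vec_def)
  then show "convex {v::real ^ 'l. 0 \<le> v}" "closed {v::real ^ 'l. 0 \<le> v}"
    using convex_closed_polyhedron[of "- mat 1 :: real ^ 'l ^ 'l" 0] by simp_all
  show "\<forall>z\<in>{v. 0 \<le> v}. dist u 0 \<le> dist u z"
    using assms by (auto simp: dist_norm less_eq_vec_def intro!: norm_le_componentwise_cart)
      (smt (verit) abs_le_iff)
qed simp

lemma GDERIV_linear_compose:
  fixes X :: "real ^ 'd ^ 'n"
  assumes "GDERIV h (X *v w) :> g"
  shows "GDERIV (\<lambda>w. h (X *v w) + q \<bullet> w) w :> transpose X *v g + q"
proof -
  have "((\<lambda>w. X *v w) has_derivative (\<lambda>v. X *v v)) (at w)"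
    by (simp add: bounded_linear_imp_has_derivative)
  from has_derivative_compose[OF this assms[unfolded gderiv_def]]
  have "((\<lambda>w. h (X *v w)) has_derivative (\<lambda>v. (X *v v) \<bullet> g)) (at w)" .
  then have "((\<lambda>w. h (X *v w) + q \<bullet> w) has_derivative (\<lambda>v. (X *v v) \<bullet> g + q \<bullet> v)) (at w)"
    by (auto intro!: derivative_eq_intros)
  moreover have "(\<lambda>v. (X *v v) \<bullet> g + q \<bullet> v) = (\<lambda>v. v \<bullet> (transpose X *v g + q))"
    by (simp add: fun_eq_iff inner_add_right dot_lmul_matrix[symmetric] inner_commute)
  ultimately show ?thesis
    by (simp add: gderiv_def)
qed

text \<open>In the growth constant, \<open>(1 + 2 G\<^sup>2)/\<mu>\<close> with \<open>G\<close> the norm of \<open>grad h r\<close> comes from the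
  residual \<open>X *v w - r\<close> and from its contribution to \<open>q \<bullet> w - s\<close>; \<open>M\<close> comes from linearizing the
  squared gap that remains in \<open>(q \<bullet> w - s)\<^sup>2\<close>.\<close>

lemma hoffman_quadratic_growth:
  fixes X :: "real ^ 'd ^ 'n" and C :: "real ^ 'd ^ 'l"
  assumes f_eq: "f = (\<lambda>w. h (X *v w) + q \<bullet> w)"
    and diff: "h differentiable (at r)"
    and W: "W = {w. C *v w \<le> b}"
    and opt: "\<And>v. v \<in> Wopt \<Longrightarrow> v \<in> W" "\<And>v w. v \<in> Wopt \<Longrightarrow> w \<in> W \<Longrightarrow> f v \<le> f w"
    and rs: "\<And>v. v \<in> Wopt \<Longrightarrow> X *v v = r" "\<And>v. v \<in> Wopt \<Longrightarrow> q \<bullet> v = s"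
    and \<mu>: "strongly_convex_on \<mu> U h"
    and hoffman: "hoffman_constant \<theta> Wopt C b X r q s"
    and M: "M > 0"
    and w: "w \<in> W" "X *v w \<in> U" "r \<in> U" "f w - (h r + s) \<le> M"
  shows "\<exists>v\<in>Wopt. (norm (w - v))\<^sup>2
    \<le> 2 * (\<theta>\<^sup>2 * ((1 + 2 * (norm (grad h r))\<^sup>2) / \<mu> + M)) * (f w - (h r + s))"
proof -
  define a where "a = norm (X *v w - r)"
  define c where "c = q \<bullet> w - s"
  define g where "g = grad h r \<bullet> (X *v w - r)"
  define G where "G = norm (grad h r)"
  define \<epsilon> where "\<epsilon> = f w - (h r + s)"
  have "\<mu> > 0" and sc: "h r + g + \<mu> / 2 * a\<^sup>2 \<le> h (X *v w)"
    using \<mu> w by (auto simp: strongly_convex_on_def a_def g_def)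
  obtain v where v: "v \<in> Wopt" and dist: "(norm (w - v))\<^sup>2
      \<le> \<theta>\<^sup>2 * ((norm (pos_part (C *v w - b)))\<^sup>2 + a\<^sup>2 + c\<^sup>2)"
    using hoffman unfolding hoffman_constant_def a_def c_def by blast
  have fd: "GDERIV f v :> transpose X *v grad h r + q"
    unfolding f_eq by (rule GDERIV_linear_compose) (simp add: rs v GDERIV_grad diff)
  have "convex W"
    unfolding W by (rule convex_closed_polyhedron)
  then have "0 \<le> grad f v \<bullet> (w - v)"
    using opt v w fd by (intro grad_at_constrained_minimum) 
      (auto simp: gderiv_def differentiable_def)
  \<comment> \<open>The gradient of \<open>f\<close> sees only the two residuals, because \<open>f\<close> factors through \<open>X\<close> and \<open>q\<close>.\<close>
  also have "grad f v \<bullet> (w - v) = g + c"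
    unfolding grad_eqI[OF fd] using rs v
    by (simp add: g_def c_def inner_add_left dot_lmul_matrix matrix_vector_mult_diff_distrib inner_diff_right)
  finally have gc: "0 \<le> g + c" .
  have \<epsilon>: "g + c + \<mu> / 2 * a\<^sup>2 \<le> \<epsilon>"
    using sc by (simp add: \<epsilon>_def f_eq c_def)
  have "0 \<le> \<mu> / 2 * a\<^sup>2"
    using \<open>\<mu> > 0\<close> by simp
  with \<epsilon> gc have \<epsilon>0: "0 \<le> \<epsilon>" "g + c \<le> \<epsilon>" and "\<mu> / 2 * a\<^sup>2 \<le> \<epsilon>"
    by linarith+
  then have a: "a\<^sup>2 \<le> 2 / \<mu> * \<epsilon>"
    using \<open>\<mu> > 0\<close> by (simp add: field_simps)
  have "\<bar>g\<bar> \<le> G * a"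
    unfolding g_def G_def a_def by (rule Cauchy_Schwarz_ineq2)
  with gc \<epsilon>0 have "\<bar>c\<bar> \<le> G * a + \<epsilon>"
    by linarith
  then have "c\<^sup>2 \<le> (G * a + \<epsilon>)\<^sup>2"
    by (metis abs_ge_zero power2_abs power_mono)
  also have "\<dots> \<le> 2 * (G * a)\<^sup>2 + 2 * \<epsilon>\<^sup>2"
    using sum_squares_bound[of "G * a" \<epsilon>] by (simp add: power2_sum)
  also have "\<dots> = 2 * G\<^sup>2 * a\<^sup>2 + 2 * (\<epsilon> * \<epsilon>)"
    by (simp add: power_mult_distrib power2_eq_square)
  also have "\<dots> \<le> 2 * G\<^sup>2 * (2 / \<mu> * \<epsilon>) + 2 * (M * \<epsilon>)"
    using a w(4) \<epsilon>0 by (intro add_mono mult_left_mono mult_right_mono) (auto simp: \<epsilon>_def)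
  finally have "a\<^sup>2 + c\<^sup>2 \<le> 2 / \<mu> * \<epsilon> + (2 * G\<^sup>2 * (2 / \<mu> * \<epsilon>) + 2 * (M * \<epsilon>))"
    using a by linarith
  also have "\<dots> = 2 * ((1 + 2 * G\<^sup>2) / \<mu> + M) * \<epsilon>"
    using \<open>\<mu> > 0\<close> by (simp add: field_simps)
  finally have "\<theta>\<^sup>2 * (a\<^sup>2 + c\<^sup>2) \<le> \<theta>\<^sup>2 * (2 * ((1 + 2 * G\<^sup>2) / \<mu> + M) * \<epsilon>)"
    by (rule mult_left_mono) simp
  moreover have "pos_part (C *v w - b) = 0"
    using w(1) by (intro pos_part_eq_0) (simp add: W)
  ultimately have "(norm (w - v))\<^sup>2 \<le> 2 * (\<theta>\<^sup>2 * ((1 + 2 * G\<^sup>2) / \<mu> + M)) * \<epsilon>"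
    using dist by (simp add: algebra_simps)
  with v show ?thesis
    unfolding G_def \<epsilon>_def by blast
qed

section \<open>The variance-reduced direction and one projected step\<close>

lemma weighted_variance_le_second_moment:
  fixes a :: "'i::finite \<Rightarrow> 'a::real_inner"
  assumes "(\<Sum>i\<in>UNIV. p i) = 1"
  shows "(\<Sum>i\<in>UNIV. p i * (norm (a i - (\<Sum>j\<in>UNIV. p j *\<^sub>R a j)))\<^sup>2) \<le> (\<Sum>i\<in>UNIV. p i * (norm (a i))\<^sup>2)"
proof -
  define c where "c = (\<Sum>j\<in>UNIV. p j *\<^sub>R a j)"
  have "(\<Sum>i\<in>UNIV. p i * (norm (a i - c))\<^sup>2)
      = (\<Sum>i\<in>UNIV. p i * (norm (a i))\<^sup>2 - 2 * ((p i *\<^sub>R a i) \<bullet> c) + p i * (norm c)\<^sup>2)"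
    by (rule sum.cong) (simp_all add: power2_norm_eq_inner inner_diff inner_commute algebra_simps)
  also have "\<dots> = (\<Sum>i\<in>UNIV. p i * (norm (a i))\<^sup>2) - 2 * (c \<bullet> c) + (norm c)\<^sup>2"
    unfolding sum.distrib sum_subtractf sum_distrib_right[symmetric] sum_distrib_left[symmetric]
      inner_sum_left[symmetric] assms c_def[symmetric] by simp
  also have "\<dots> \<le> (\<Sum>i\<in>UNIV. p i * (norm (a i))\<^sup>2)"
    by (simp add: power2_norm_eq_inner)
  finally show ?thesis
    by (simp add: c_def)
qed

lemma norm_diff_squared_le:
  fixes a b :: "'a::real_inner"
  shows "(norm (a - b))\<^sup>2 \<le> 2 * (norm a)\<^sup>2 + 2 * (norm b)\<^sup>2"
proof -
  have "0 \<le> (norm (a + b))\<^sup>2"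
    by simp
  then show ?thesis
    by (simp add: power2_norm_eq_inner inner_diff inner_add inner_commute)
qed

text \<open>An average of smooth convex functions sampled with probabilities \<open>p\<close>. The bound on \<open>Lc\<close> is the
  division-free form of \<open>Lc i / (n p i) \<le> LP\<close>: the number \<open>LP\<close> is a smoothness constant of every
  importance-weighted component \<open>fc i / (n p i)\<close>, and by averaging also one of \<open>f\<close>.\<close>

locale weighted_finite_sum =
  fixes f :: "real ^ 'd \<Rightarrow> real" and fc :: "'n::finite \<Rightarrow> real ^ 'd \<Rightarrow> real"
    and Lc p :: "'n \<Rightarrow> real" and LP :: real
  assumes average: "f w = (1 / of_nat CARD('n)) * (\<Sum>i\<in>UNIV. fc i w)"
    and component_convex: "convex_on UNIV (fc i)"
    and component_diff: "fc i differentiable (at w)"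
    and Lc_pos: "Lc i > 0"
    and component_lipschitz: "(Lc i)-lipschitz_on UNIV (grad (fc i))"
    and p_pos: "p i > 0" and p_sum: "(\<Sum>i\<in>UNIV. p i) = 1"
    and Lc_le: "Lc i \<le> LP * (of_nat CARD('n) * p i)"
begin

lemma GDERIV_average: "GDERIV f w :> (1 / of_nat CARD('n)) *\<^sub>R (\<Sum>i\<in>UNIV. grad (fc i) w)"
proof -
  have "(fc i has_derivative (\<lambda>v. v \<bullet> grad (fc i) w)) (at w)" for i
    using GDERIV_grad[OF component_diff] unfolding gderiv_def .
  then have "((\<lambda>w. (1 / of_nat CARD('n)) * (\<Sum>i\<in>UNIV. fc i w)) has_derivative
      (\<lambda>v. (1 / of_nat CARD('n)) * (\<Sum>i\<in>UNIV. v \<bullet> grad (fc i) w))) (at w)"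
    by (auto intro!: derivative_eq_intros)
  moreover have "f = (\<lambda>w. (1 / of_nat CARD('n)) * (\<Sum>i\<in>UNIV. fc i w))"
    using average by blast
  ultimately show ?thesis
    by (simp add: gderiv_def inner_sum_right)
qed

lemmas grad_average = grad_eqI[OF GDERIV_average]

lemma diff: "f differentiable (at w)"
  using GDERIV_average[of w] unfolding gderiv_def differentiable_def by blast

lemma LP_pos: "LP > 0"
proof -
  have "0 < LP * (of_nat CARD('n) * p undefined)"
    using Lc_pos Lc_le by (rule less_le_trans)
  moreover have "0 < of_nat CARD('n) * p undefined"
    using p_pos by simp
  ultimately show ?thesis
    by (simp add: zero_less_mult_iff)
qed

lemma average_gap:
  "f x - f y - grad f y \<bullet> (x - y)
    = (1 / of_nat CARD('n)) * (\<Sum>i\<in>UNIV. fc i x - fc i y - grad (fc i) y \<bullet> (x - y))"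
  unfolding average grad_average
  by (simp add: sum_subtractf inner_sum_left right_diff_distrib diff_divide_distrib)

lemma convex: "convex_on UNIV f"
proof -
  have "convex_on UNIV (\<lambda>w. \<Sum>i\<in>A. fc i w)" if "finite A" for A
    using that by induction (auto intro!: convex_on_add component_convex simp: convex_on_const)
  then have "convex_on UNIV (\<lambda>w. (1 / of_nat CARD('n)) * (\<Sum>i\<in>UNIV. fc i w))"
    by (intro convex_on_cmul) auto
  moreover have "f = (\<lambda>w. (1 / of_nat CARD('n)) * (\<Sum>i\<in>UNIV. fc i w))"
    using average by blast
  ultimately show ?thesis
    by simp
qed

lemma quadratic_upper_bound: "f y \<le> f x + grad f x \<bullet> (y - x) + LP / 2 * (norm (y - x))\<^sup>2"
proof -
  have "(\<Sum>i\<in>UNIV. fc i y - fc i x - grad (fc i) x \<bullet> (y - x))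
      \<le> (\<Sum>i\<in>UNIV. (LP * (of_nat CARD('n) * p i)) / 2 * (norm (y - x))\<^sup>2)"
  proof (rule sum_mono)
    fix i
    have "fc i y - fc i x - grad (fc i) x \<bullet> (y - x) \<le> Lc i / 2 * (norm (y - x))\<^sup>2"
      using lipschitz_grad_quadratic_upper_bound[OF component_diff component_lipschitz, of i y x]
      by simp
    also have "\<dots> \<le> (LP * (of_nat CARD('n) * p i)) / 2 * (norm (y - x))\<^sup>2"
      using Lc_le by (intro mult_right_mono divide_right_mono) auto
    finally show "fc i y - fc i x - grad (fc i) x \<bullet> (y - x)
        \<le> (LP * (of_nat CARD('n) * p i)) / 2 * (norm (y - x))\<^sup>2" .
  qed
  also have "\<dots> = (\<Sum>i\<in>UNIV. p i) * (of_nat CARD('n) * (LP / 2 * (norm (y - x))\<^sup>2))"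
    unfolding sum_distrib_right by (simp add: mult_ac)
  finally have "f y - f x - grad f x \<bullet> (y - x) \<le> LP / 2 * (norm (y - x))\<^sup>2"
    unfolding average_gap p_sum by (simp add: field_simps)
  then show ?thesis
    by simp
qed

text \<open>The importance weights cancel one factor \<open>p i\<close>, and \<open>Lc i / (n p i) \<le> LP\<close> makes the remaining weights
  uniform, so that the component divergences add up to that of \<open>f\<close>.\<close>

lemma weighted_gradient_second_moment:
  "(\<Sum>i\<in>UNIV. p i * (norm ((grad (fc i) x - grad (fc i) y) /\<^sub>R (of_nat CARD('n) * p i)))\<^sup>2)
    \<le> 2 * LP * (f x - f y - grad f y \<bullet> (x - y))"
proof -
  let ?n = "of_nat CARD('n) :: real"
  let ?D = "\<lambda>i. fc i x - fc i y - grad (fc i) y \<bullet> (x - y)"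
  have "p i * (norm ((grad (fc i) x - grad (fc i) y) /\<^sub>R (?n * p i)))\<^sup>2 \<le> 2 * LP * (1 / ?n * ?D i)"
    for i
  proof -
    have D: "0 \<le> ?D i"
      using convex_above_tangent_plane[OF component_convex component_diff, of i y x] by simp
    have "(norm (grad (fc i) x - grad (fc i) y))\<^sup>2 \<le> 2 * Lc i * ?D i"
      by (rule convex_lipschitz_grad_bregman_bound
          [OF component_convex component_diff Lc_pos component_lipschitz])
    also have "\<dots> \<le> 2 * (LP * (?n * p i)) * ?D i"
      using D Lc_le by (intro mult_right_mono mult_left_mono) auto
    finally have "(norm (grad (fc i) x - grad (fc i) y))\<^sup>2 / (?n\<^sup>2 * p i)
        \<le> (2 * (LP * (?n * p i)) * ?D i) / (?n\<^sup>2 * p i)"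
      using p_pos[of i] by (intro divide_right_mono) auto
    also have "\<dots> = 2 * LP * (1 / ?n * ?D i)"
      using p_pos[of i] by (simp add: power2_eq_square)
    also have "(norm (grad (fc i) x - grad (fc i) y))\<^sup>2 / (?n\<^sup>2 * p i)
        = p i * (norm ((grad (fc i) x - grad (fc i) y) /\<^sub>R (?n * p i)))\<^sup>2"
      using p_pos[of i] by (simp add: power_mult_distrib power_divide power_inverse)
        (simp add: power2_eq_square field_simps)
    finally show ?thesis .
  qed
  then have "(\<Sum>i\<in>UNIV. p i * (norm ((grad (fc i) x - grad (fc i) y) /\<^sub>R (?n * p i)))\<^sup>2)
      \<le> (\<Sum>i\<in>UNIV. 2 * LP * (1 / ?n * ?D i))"
    by (rule sum_mono)
  then show ?thesis
    unfolding average_gap sum_distrib_left .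
qed

lemma mean_scaled_difference:
  "(\<Sum>i\<in>UNIV. p i *\<^sub>R ((grad (fc i) x - grad (fc i) y) /\<^sub>R (of_nat CARD('n) * p i)))
    = grad f x - grad f y"
proof -
  have "p i *\<^sub>R ((grad (fc i) x - grad (fc i) y) /\<^sub>R (of_nat CARD('n) * p i))
      = (1 / of_nat CARD('n)) *\<^sub>R (grad (fc i) x - grad (fc i) y)" for i
    using p_pos[of i] by (simp add: divide_simps)
  then show ?thesis
    by (simp only: grad_average sum_subtractf scaleR_sum_right[symmetric]
        scaleR_diff_right[symmetric])
qed

lemma direction_unbiased:
  "(\<Sum>i\<in>UNIV. p i *\<^sub>R (vrpsg_direction f fc p snap w i - grad f w)) = 0"
proof -
  have "(\<Sum>i\<in>UNIV. p i *\<^sub>R (vrpsg_direction f fc p snap w i - grad f w))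
      = (grad f w - grad f snap) + (\<Sum>i\<in>UNIV. p i) *\<^sub>R (grad f snap - grad f w)"
    unfolding mean_scaled_difference[of w snap, symmetric] scaleR_sum_left sum.distrib[symmetric]
    by (rule sum.cong) (simp_all add: vrpsg_direction_def algebra_simps)
  then show ?thesis
    by (simp add: p_sum)
qed

text \<open>The direction is \<open>grad f snap\<close> plus an importance-weighted gradient difference between \<open>w\<close> and
  \<open>snap\<close>. Its variance is at most the second moment of that difference, which is split at the
  point \<open>y\<close>; if \<open>y\<close> satisfies the first-order optimality condition, Bregman divergences from \<open>y\<close>
  are bounded by gaps.\<close>

lemma direction_variance:
  assumes "0 \<le> grad f y \<bullet> (w - y)" "0 \<le> grad f y \<bullet> (snap - y)"
  shows "(\<Sum>i\<in>UNIV. p i * (norm (vrpsg_direction f fc p snap w i - grad f w))\<^sup>2)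
    \<le> 4 * LP * ((f w - f y) + (f snap - f y))"
proof -
  define a where "a x z i = (grad (fc i) x - grad (fc i) z) /\<^sub>R (of_nat CARD('n) * p i)" for x z i
  have moment: "(\<Sum>i\<in>UNIV. p i * (norm (a x y i))\<^sup>2) \<le> 2 * LP * (f x - f y)"
    if "0 \<le> grad f y \<bullet> (x - y)" for x
  proof -
    have "(\<Sum>i\<in>UNIV. p i * (norm (a x y i))\<^sup>2) \<le> 2 * LP * (f x - f y - grad f y \<bullet> (x - y))"
      unfolding a_def by (rule weighted_gradient_second_moment)
    also have "\<dots> \<le> 2 * LP * (f x - f y)"
      using that LP_pos by (intro mult_left_mono) auto
    finally show ?thesis .
  qed
  have "(\<Sum>i\<in>UNIV. p i * (norm (vrpsg_direction f fc p snap w i - grad f w))\<^sup>2)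
      = (\<Sum>i\<in>UNIV. p i * (norm (a w snap i - (\<Sum>j\<in>UNIV. p j *\<^sub>R a w snap j)))\<^sup>2)"
    unfolding a_def mean_scaled_difference by (simp add: vrpsg_direction_def algebra_simps)
  also have "\<dots> \<le> (\<Sum>i\<in>UNIV. p i * (norm (a w snap i))\<^sup>2)"
    by (rule weighted_variance_le_second_moment[OF p_sum])
  also have "\<dots> \<le> (\<Sum>i\<in>UNIV. p i * (2 * (norm (a w y i))\<^sup>2 + 2 * (norm (a snap y i))\<^sup>2))"
  proof (intro sum_mono mult_left_mono)
    fix i
    have "a w snap i = a w y i - a snap y i"
      by (simp add: a_def scaleR_diff_right[symmetric])
    then show "(norm (a w snap i))\<^sup>2 \<le> 2 * (norm (a w y i))\<^sup>2 + 2 * (norm (a snap y i))\<^sup>2"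
      using norm_diff_squared_le by metis
  qed (simp add: p_pos less_imp_le)
  also have "\<dots> = 2 * (\<Sum>i\<in>UNIV. p i * (norm (a w y i))\<^sup>2) + 2 * (\<Sum>i\<in>UNIV. p i * (norm (a snap y i))\<^sup>2)"
    by (simp add: sum_distrib_left sum.distrib[symmetric] algebra_simps)
  also have "\<dots> \<le> 2 * (2 * LP * (f w - f y)) + 2 * (2 * LP * (f snap - f y))"
    using assms by (intro add_mono mult_left_mono moment) auto
  finally show ?thesis
    by (simp add: algebra_simps)
qed

text \<open>The error \<open>v - grad f w\<close> enters through its inner product with \<open>u - y\<close>, which is correlated with
  \<open>v\<close>. Comparing \<open>u\<close> with the point \<open>u'\<close> that the exact gradient would have produced isolates a term
  quadratic in the error (projections are nonexpansive) from a term that is linear in it and hence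
  averages to zero.\<close>

lemma perturbed_projected_gradient_step:
  fixes v w y :: "real ^ 'd"
  assumes W: "convex W" "closed W" "y \<in> W" and \<eta>: "0 < \<eta>" "\<eta> * LP \<le> 1"
  defines "u \<equiv> closest_point W (w - \<eta> *\<^sub>R v)"
    and "u' \<equiv> closest_point W (w - \<eta> *\<^sub>R grad f w)"
  shows "(norm (u - y))\<^sup>2 + 2 * \<eta> * (f u - f y)
    \<le> (norm (w - y))\<^sup>2 + 2 * \<eta>\<^sup>2 * (norm (v - grad f w))\<^sup>2
      - 2 * \<eta> * ((v - grad f w) \<bullet> (u' - y))"
proof -
  define \<Delta> where "\<Delta> = v - grad f w"
  have "f u - f y \<le> grad f w \<bullet> (u - y) + LP / 2 * (norm (u - w))\<^sup>2"
    using quadratic_upper_bound[of u w] convex_above_tangent_plane[OF convex diff, of w y]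
    by (simp add: inner_diff_right)
  also have "grad f w \<bullet> (u - y) = v \<bullet> (u - y) - \<Delta> \<bullet> (u - y)"
    by (simp add: \<Delta>_def inner_diff_left)
  finally have "2 * \<eta> * (f u - f y)
      \<le> 2 * \<eta> * (v \<bullet> (u - y) - \<Delta> \<bullet> (u - y) + LP / 2 * (norm (u - w))\<^sup>2)"
    using \<eta> by (intro mult_left_mono) auto
  also have "\<dots> = 2 * (\<eta> * (v \<bullet> (u - y))) - 2 * \<eta> * (\<Delta> \<bullet> (u - y)) + (\<eta> * LP) * (norm (u - w))\<^sup>2"
    by (simp add: algebra_simps)
  finally have descent: "2 * \<eta> * (f u - f y)
      \<le> 2 * (\<eta> * (v \<bullet> (u - y))) - 2 * \<eta> * (\<Delta> \<bullet> (u - y)) + (\<eta> * LP) * (norm (u - w))\<^sup>2" .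
  have smooth: "(\<eta> * LP) * (norm (u - w))\<^sup>2 \<le> 1 * (norm (u - w))\<^sup>2"
    using \<eta> by (intro mult_right_mono) auto
  have "(w - \<eta> *\<^sub>R v - u) \<bullet> (y - u) \<le> 0"
    unfolding u_def using W by (rule closest_point_dot)
  then have obtuse: "\<eta> * (v \<bullet> (u - y)) \<le> (w - u) \<bullet> (u - y)"
    by (simp add: inner_diff right_diff_distrib)
  have three_point: "2 * ((w - u) \<bullet> (u - y))
      = (norm (w - y))\<^sup>2 - (norm (u - w))\<^sup>2 - (norm (u - y))\<^sup>2"
    by (simp add: power2_norm_eq_inner inner_diff inner_commute algebra_simps)
  have "dist u u' \<le> dist (w - \<eta> *\<^sub>R v) (w - \<eta> *\<^sub>R grad f w)"
    unfolding u_def u'_def using W by (intro closest_point_lipschitz) auto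
  also have "\<dots> = norm (\<eta> *\<^sub>R \<Delta>)"
    by (simp add: dist_norm \<Delta>_def scaleR_diff_right norm_minus_commute)
  finally have "norm (u - u') \<le> \<eta> * norm \<Delta>"
    using \<eta> by (simp add: dist_norm)
  then have "norm \<Delta> * norm (u - u') \<le> norm \<Delta> * (\<eta> * norm \<Delta>)"
    by (rule mult_left_mono) simp
  moreover have "- (\<Delta> \<bullet> (u - u')) \<le> norm \<Delta> * norm (u - u')"
    using Cauchy_Schwarz_ineq2[of \<Delta> "u - u'"] by linarith
  ultimately have "- (\<Delta> \<bullet> (u - u')) \<le> \<eta> * (norm \<Delta>)\<^sup>2"
    by (simp add: power2_eq_square mult_ac)
  then have "2 * \<eta> * - (\<Delta> \<bullet> (u - u')) \<le> 2 * \<eta> * (\<eta> * (norm \<Delta>)\<^sup>2)"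
    using \<eta> by (intro mult_left_mono) auto
  moreover have "\<Delta> \<bullet> (u - y) = \<Delta> \<bullet> (u - u') + \<Delta> \<bullet> (u' - y)"
    by (simp add: inner_diff_right)
  ultimately have "- 2 * \<eta> * (\<Delta> \<bullet> (u - y))
      \<le> 2 * \<eta>\<^sup>2 * (norm \<Delta>)\<^sup>2 - 2 * \<eta> * (\<Delta> \<bullet> (u' - y))"
    by (simp add: power2_eq_square algebra_simps)
  with descent smooth obtuse three_point show ?thesis
    by (simp add: \<Delta>_def)
qed

lemma expected_projected_step:
  fixes w snap y :: "real ^ 'd"
  assumes W: "convex W" "closed W" and mem: "y \<in> W" "w \<in> W" "snap \<in> W"
    and min: "\<And>z. z \<in> W \<Longrightarrow> f y \<le> f z" and \<eta>: "0 < \<eta>" "\<eta> * LP \<le> 1"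
  defines "u \<equiv> \<lambda>i. closest_point W (w - \<eta> *\<^sub>R vrpsg_direction f fc p snap w i)"
  shows "(\<Sum>i\<in>UNIV. p i * ((norm (u i - y))\<^sup>2 + 2 * \<eta> * (f (u i) - f y)))
    \<le> (norm (w - y))\<^sup>2 + 8 * \<eta>\<^sup>2 * LP * ((f w - f y) + (f snap - f y))"
proof -
  define \<Delta> where "\<Delta> i = vrpsg_direction f fc p snap w i - grad f w" for i
  define u' where "u' = closest_point W (w - \<eta> *\<^sub>R grad f w)"
  have "(\<Sum>i\<in>UNIV. p i * ((norm (u i - y))\<^sup>2 + 2 * \<eta> * (f (u i) - f y)))
      \<le> (\<Sum>i\<in>UNIV. p i * ((norm (w - y))\<^sup>2 + 2 * \<eta>\<^sup>2 * (norm (\<Delta> i))\<^sup>2 - 2 * \<eta> * (\<Delta> i \<bullet> (u' - y))))"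
    unfolding u_def u'_def \<Delta>_def using p_pos
    by (intro sum_mono mult_left_mono perturbed_projected_gradient_step W mem \<eta>) (simp add: less_imp_le)
  also have "\<dots> = (\<Sum>i\<in>UNIV. p i) * (norm (w - y))\<^sup>2 + 2 * \<eta>\<^sup>2 * (\<Sum>i\<in>UNIV. p i * (norm (\<Delta> i))\<^sup>2)
      - 2 * \<eta> * ((\<Sum>i\<in>UNIV. p i *\<^sub>R \<Delta> i) \<bullet> (u' - y))"
    unfolding sum_distrib_right sum_distrib_left inner_sum_left
      sum.distrib[symmetric] sum_subtractf[symmetric]
    by (rule sum.cong) (simp_all add: algebra_simps)
  also have "\<dots> = (norm (w - y))\<^sup>2 + 2 * \<eta>\<^sup>2 * (\<Sum>i\<in>UNIV. p i * (norm (\<Delta> i))\<^sup>2)"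
    using direction_unbiased[of snap w] by (simp add: p_sum \<Delta>_def)
  also have "\<dots> \<le> (norm (w - y))\<^sup>2 + 2 * \<eta>\<^sup>2 * (4 * LP * ((f w - f y) + (f snap - f y)))"
    unfolding \<Delta>_def using min mem
    by (intro add_left_mono mult_left_mono direction_variance
        grad_at_constrained_minimum[OF W(1)] diff) auto
  also have "\<dots> = (norm (w - y))\<^sup>2 + 8 * \<eta>\<^sup>2 * LP * ((f w - f y) + (f snap - f y))"
    by algebra
  finally show ?thesis .
qed

end

section \<open>Expectations over finitely many random indices\<close>

context prob_space
begin

lemma measurable_finite_history:
  fixes H :: "('i \<Rightarrow> 'n::finite) \<Rightarrow> 'b"
  assumes "finite K"
  shows "H \<in> measurable (PiM K (\<lambda>_. count_space (UNIV :: 'n set))) N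
    \<longleftrightarrow> (\<forall>x\<in>K \<rightarrow>\<^sub>E UNIV. H x \<in> space N)"
  using assms by (subst count_space_PiM_finite) (auto simp: measurable_def Pi_def)

text \<open>A function of finitely many variables with values in a finite type is measurable and bounded.\<close>

lemma integrable_finite_history:
  fixes J :: "'i \<Rightarrow> 'a \<Rightarrow> 'n::finite" and H :: "('i \<Rightarrow> 'n) \<Rightarrow> real"
  assumes J: "\<And>k. k \<in> K \<Longrightarrow> J k \<in> measurable M (count_space UNIV)" and K: "finite K"
    and H: "\<And>x y. (\<And>k. k \<in> K \<Longrightarrow> x k = y k) \<Longrightarrow> H x = H y"
  shows "integrable M (\<lambda>\<omega>. H (\<lambda>k. J k \<omega>))"
proof -
  have H': "(\<lambda>\<omega>. H (\<lambda>k. J k \<omega>)) = (\<lambda>\<omega>. H (\<lambda>k\<in>K. J k \<omega>))"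
    by (intro ext H) simp
  have "(\<lambda>\<omega>. \<lambda>k\<in>K. J k \<omega>) \<in> measurable M (PiM K (\<lambda>_. count_space UNIV))"
    using J by (rule measurable_restrict)
  then have "(\<lambda>\<omega>. H (\<lambda>k\<in>K. J k \<omega>)) \<in> borel_measurable M"
    by (rule measurable_compose) (simp add: measurable_finite_history[OF K])
  moreover have "bounded (H ` (K \<rightarrow>\<^sub>E UNIV))"
    using K by (intro finite_imp_bounded finite_imageI finite_PiE) auto
  then obtain c where c: "\<forall>y\<in>H ` (K \<rightarrow>\<^sub>E UNIV). norm y \<le> c"
    unfolding bounded_iff by blast
  then have "norm (H (\<lambda>k\<in>K. J k \<omega>)) \<le> c" for \<omega>
    by (rule bspec) simp
  ultimately show ?thesis
    unfolding H' by (intro integrable_const_bound[where B = c]) auto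
qed

text \<open>The discrete form of conditioning on the variables in \<open>K\<close>: splitting by the value of \<open>J a\<close> writes the
  integrand as a sum of products of an indicator with a function of the variables in \<open>K\<close>, and
  independence factors each product.\<close>

lemma expectation_fresh_index:
  fixes J :: "'i \<Rightarrow> 'a \<Rightarrow> 'n::finite" and H :: "('i \<Rightarrow> 'n) \<Rightarrow> 'n \<Rightarrow> real"
  assumes indep: "indep_vars (\<lambda>_. count_space UNIV) J I"
    and K: "finite K" "K \<subseteq> I" and a: "a \<in> I" "a \<notin> K"
    and prob: "\<And>i. prob {\<omega> \<in> space M. J a \<omega> = i} = p i"
    and H: "\<And>x y i. (\<And>k. k \<in> K \<Longrightarrow> x k = y k) \<Longrightarrow> H x i = H y i"
  shows "expectation (\<lambda>\<omega>. H (\<lambda>k. J k \<omega>) (J a \<omega>)) = expectation (\<lambda>\<omega>. \<Sum>i\<in>UNIV. p i * H (\<lambda>k. J k \<omega>) i)"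
proof -
  have J: "J k \<in> measurable M (count_space UNIV)" if "k \<in> I" for k
    using indep that by (simp add: indep_vars_def)
  have int: "integrable M (\<lambda>\<omega>. H (\<lambda>k. J k \<omega>) i)" for i
    by (rule integrable_finite_history[OF J K(1)]) (use K(2) in blast, rule H)
  define hit where "hit i \<omega> = (indicator {i} (J a \<omega>) :: real)" for i \<omega>
  have ev: "{\<omega> \<in> space M. J a \<omega> = i} \<in> sets M" for i
    using measurable_sets[OF J[OF a(1)], of "{i}"] by (simp add: vimage_def Int_def conj_commute)
  have hit: "has_bochner_integral M (hit i) (p i)" for i
  proof -
    have "has_bochner_integral M (indicator {\<omega> \<in> space M. J a \<omega> = i} :: _ \<Rightarrow> real) (p i)"
      using has_bochner_integral_real_indicator[OF ev[of i]] by (simp add: prob less_top[symmetric])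
    then show ?thesis
      by (rule has_bochner_integral_cong[THEN iffD1, rotated -1]) (auto simp: hit_def indicator_def)
  qed
  have hit_int: "integrable M (hit i)" "expectation (hit i) = p i" for i
    using hit[of i] by (auto simp: has_bochner_integral_iff)
  have indep_hit: "indep_var borel (hit i) borel (\<lambda>\<omega>. H (\<lambda>k. J k \<omega>) i)" for i
  proof -
    have "indep_var (PiM {a} (\<lambda>_. count_space UNIV)) (\<lambda>\<omega>. \<lambda>k\<in>{a}. J k \<omega>)
        (PiM K (\<lambda>_. count_space UNIV)) (\<lambda>\<omega>. \<lambda>k\<in>K. J k \<omega>)"
      using K a by (intro indep_var_restrict[OF indep]) auto
    then have "indep_var borel ((\<lambda>x. indicator {i} (x a) :: real) \<circ> (\<lambda>\<omega>. \<lambda>k\<in>{a}. J k \<omega>))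
        borel ((\<lambda>x. H x i) \<circ> (\<lambda>\<omega>. \<lambda>k\<in>K. J k \<omega>))"
      by (rule indep_var_compose) (simp_all add: measurable_finite_history K)
    moreover have "(\<lambda>x. H x i) \<circ> (\<lambda>\<omega>. \<lambda>k\<in>K. J k \<omega>) = (\<lambda>\<omega>. H (\<lambda>k. J k \<omega>) i)"
      unfolding comp_def by (intro ext H) simp
    moreover have "(\<lambda>x. indicator {i} (x a)) \<circ> (\<lambda>\<omega>. \<lambda>k\<in>{a}. J k \<omega>) = hit i"
      by (simp add: comp_def hit_def fun_eq_iff)
    ultimately show ?thesis
      by simp
  qed
  have "expectation (\<lambda>\<omega>. H (\<lambda>k. J k \<omega>) (J a \<omega>))
      = expectation (\<lambda>\<omega>. \<Sum>i\<in>UNIV. hit i \<omega> * H (\<lambda>k. J k \<omega>) i)"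
    by (rule Bochner_Integration.integral_cong)
      (auto simp: hit_def indicator_def if_distrib[of "\<lambda>c. c * _"] cong: if_cong)
  also have "\<dots> = (\<Sum>i\<in>UNIV. expectation (\<lambda>\<omega>. hit i \<omega> * H (\<lambda>k. J k \<omega>) i))"
    by (rule Bochner_Integration.integral_sum)
      (rule indep_var_integrable[OF indep_hit hit_int(1) int])
  also have "\<dots> = (\<Sum>i\<in>UNIV. p i * expectation (\<lambda>\<omega>. H (\<lambda>k. J k \<omega>) i))"
    by (simp add: indep_var_lebesgue_integral[OF indep_hit hit_int(1) int] hit_int)
  also have "\<dots> = expectation (\<lambda>\<omega>. \<Sum>i\<in>UNIV. p i * H (\<lambda>k. J k \<omega>) i)"
    using int by simp
  finally show ?thesis .
qed

end

section \<open>One outer iteration in expectation\<close>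

lemma vrpsg_inner_cong:
  assumes "\<And>s. 1 \<le> s \<Longrightarrow> s \<le> t \<Longrightarrow> j s = j' s"
  shows "vrpsg_inner f fc W p \<eta> snap j t = vrpsg_inner f fc W p \<eta> snap j' t"
  using assms by (induction t) (simp_all add: Let_def)

lemma vrpsg_outer_cong:
  assumes "\<And>i t. 1 \<le> i \<Longrightarrow> i \<le> k \<Longrightarrow> 1 \<le> t \<Longrightarrow> t \<le> m \<Longrightarrow> j i t = j' i t"
  shows "vrpsg_outer f fc W p \<eta> m w0 j k = vrpsg_outer f fc W p \<eta> m w0 j' k"
  using assms
proof (induction k)
  case (Suc k)
  have "vrpsg_outer f fc W p \<eta> m w0 j k = vrpsg_outer f fc W p \<eta> m w0 j' k"
    using Suc.prems by (intro Suc.IH) auto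
  moreover have "vrpsg_inner f fc W p \<eta> snap (j (Suc k)) t = vrpsg_inner f fc W p \<eta> snap (j' (Suc k)) t"
    if "t \<in> {1..m}" for snap t
    using that Suc.prems by (intro vrpsg_inner_cong) auto
  ultimately show ?case
    by simp
qed simp

text \<open>The function \<open>opt\<close> selects a minimizer for each reference point. One fixed minimizer would not do,
  because the growth bound only controls the distance to a minimizer that depends on the point.\<close>

locale vrpsg_run = weighted_finite_sum f fc Lc p LP + prob_space P
  for f :: "real ^ 'd \<Rightarrow> real" and fc :: "'n::finite \<Rightarrow> real ^ 'd \<Rightarrow> real"
    and Lc p :: "'n \<Rightarrow> real" and LP :: real and P :: "'w measure" +
  fixes W :: "(real ^ 'd) set" and \<eta> fopt :: real and m :: nat and w0 :: "real ^ 'd"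
    and J :: "nat \<Rightarrow> nat \<Rightarrow> 'w \<Rightarrow> 'n" and opt :: "real ^ 'd \<Rightarrow> real ^ 'd"
  assumes W: "convex W" "closed W" and w0: "w0 \<in> W" and m: "m \<ge> 1"
    and \<eta>: "0 < \<eta>" "4 * LP * \<eta> < 1"
    and opt: "opt x \<in> W" "f (opt x) = fopt" and fopt_le: "z \<in> W \<Longrightarrow> fopt \<le> f z"
    and indep: "indep_vars (\<lambda>_. count_space UNIV) (\<lambda>(k, t). J k t) ({1..} \<times> {1..m})"
    and prob_J: "1 \<le> k \<Longrightarrow> t \<in> {1..m} \<Longrightarrow> prob {\<omega> \<in> space P. J k t \<omega> = i} = p i"
begin

lemma \<eta>_LP: "\<eta> * LP \<le> 1"
proof -
  have "0 < \<eta> * LP"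
    using \<eta>(1) LP_pos by simp
  then show ?thesis
    using \<eta>(2) by (simp add: mult_ac)
qed

abbreviation outer :: "(nat \<Rightarrow> nat \<Rightarrow> 'n) \<Rightarrow> nat \<Rightarrow> real ^ 'd" where
  "outer \<equiv> vrpsg_outer f fc W p \<eta> m w0"

abbreviation inner_iterate :: "(nat \<Rightarrow> nat \<Rightarrow> 'n) \<Rightarrow> nat \<Rightarrow> nat \<Rightarrow> real ^ 'd" where
  "inner_iterate j k t \<equiv> vrpsg_inner f fc W p \<eta> (outer j k) (j (Suc k)) t"

abbreviation draws :: "'w \<Rightarrow> nat \<Rightarrow> nat \<Rightarrow> 'n" where
  "draws \<omega> \<equiv> \<lambda>k t. J k t \<omega>"

lemma inner_in_W: "snap \<in> W \<Longrightarrow> vrpsg_inner f fc W p \<eta> snap j t \<in> W"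
  using W w0 by (cases t) (auto simp: Let_def intro!: closest_point_in_set)

lemma outer_in_W: "outer j k \<in> W"
proof (induction k)
  case (Suc k)
  have "(\<Sum>t\<in>{1..m}. (1 / of_nat m) *\<^sub>R inner_iterate j k t) \<in> W"
    using m Suc by (intro convex_sum W inner_in_W) auto
  then show ?case
    by (simp add: scaleR_sum_right inverse_eq_divide)
qed (simp add: w0)

lemma outer_gap_le_mean:
  "f (outer j (Suc k)) - fopt \<le> (1 / of_nat m) * (\<Sum>t\<in>{1..m}. f (inner_iterate j k t) - fopt)"
proof -
  have "f (\<Sum>t\<in>{1..m}. (1 / of_nat m) *\<^sub>R inner_iterate j k t)
      \<le> (\<Sum>t\<in>{1..m}. (1 / of_nat m) * f (inner_iterate j k t))"
    using m by (intro convex_on_sum[OF _ _ convex]) auto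
  also have "(\<Sum>t\<in>{1..m}. (1 / of_nat m) *\<^sub>R inner_iterate j k t) = outer j (Suc k)"
    by (simp add: scaleR_sum_right inverse_eq_divide)
  finally show ?thesis
    using m by (simp add: sum_subtractf sum_divide_distrib diff_divide_distrib)
qed

definition history :: "nat \<Rightarrow> nat \<Rightarrow> (nat \<times> nat) set" where
  "history k t = {1..k} \<times> {1..m} \<union> {Suc k} \<times> {1..t}"

text \<open>Indices are collected in a single function on pairs, so that the independence of the whole
  doubly indexed family applies.\<close>

lemma iterates_depend_on_history:
  assumes "t \<le> m" and "\<And>a. a \<in> history k t \<Longrightarrow> x a = z a"
  shows "outer (curry x) k = outer (curry z) k"
    and "inner_iterate (curry x) k t = inner_iterate (curry z) k t"
proof -
  show "outer (curry x) k = outer (curry z) k"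
    using assms by (intro vrpsg_outer_cong) (auto simp: history_def)
  moreover have "vrpsg_inner f fc W p \<eta> snap (curry x (Suc k)) t
      = vrpsg_inner f fc W p \<eta> snap (curry z (Suc k)) t" for snap
    using assms by (intro vrpsg_inner_cong) (auto simp: history_def)
  ultimately show "inner_iterate (curry x) k t = inner_iterate (curry z) k t"
    by simp
qed

lemma history_subset: "t \<le> m \<Longrightarrow> history k t \<subseteq> {1..} \<times> {1..m}" "finite (history k t)"
  by (auto simp: history_def)

text \<open>The iterates take finitely many values, so \<open>F\<close> may be any function; in particular it may involve
  the choice \<open>opt\<close> of a minimizer.\<close>

lemma integrable_iterates:
  fixes F :: "real ^ 'd \<Rightarrow> real ^ 'd \<Rightarrow> real"
  assumes "t \<le> m"
  shows "integrable P (\<lambda>\<omega>. F (outer (draws \<omega>) k) (inner_iterate (draws \<omega>) k t))"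
proof -
  have "integrable P (\<lambda>\<omega>. (\<lambda>x. F (outer (curry x) k) (inner_iterate (curry x) k t))
      (\<lambda>a. (\<lambda>(k, t). J k t) a \<omega>))"
  proof (rule integrable_finite_history[where K = "history k t"])
    show "(\<lambda>(k, t). J k t) a \<in> measurable P (count_space UNIV)" if "a \<in> history k t" for a
      using indep that history_subset(1)[OF assms] unfolding indep_vars_def by blast
    show "F (outer (curry x) k) (inner_iterate (curry x) k t)
        = F (outer (curry z) k) (inner_iterate (curry z) k t)"
      if "\<And>a. a \<in> history k t \<Longrightarrow> x a = z a" for x z
      using arg_cong2[where f = F, OF iterates_depend_on_history[OF assms that]] .
  qed (rule history_subset)
  then show ?thesis
    by (simp add: curry_def)
qed

text \<open>The index \<open>J (Suc k) (Suc t)\<close> is not part of \<open>history k t\<close>, on which both the reference point and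
  the current iterate depend.\<close>

lemma expectation_inner_Suc:
  fixes F :: "real ^ 'd \<Rightarrow> real ^ 'd \<Rightarrow> real"
  assumes "t < m"
  shows "expectation (\<lambda>\<omega>. F (outer (draws \<omega>) k) (inner_iterate (draws \<omega>) k (Suc t)))
    = expectation (\<lambda>\<omega>. \<Sum>i\<in>UNIV. p i * F (outer (draws \<omega>) k)
        (closest_point W (inner_iterate (draws \<omega>) k t
          - \<eta> *\<^sub>R vrpsg_direction f fc p (outer (draws \<omega>) k) (inner_iterate (draws \<omega>) k t) i)))"
proof -
  define H where "H x i = F (outer (curry x) k) (closest_point W (inner_iterate (curry x) k t
    - \<eta> *\<^sub>R vrpsg_direction f fc p (outer (curry x) k) (inner_iterate (curry x) k t) i))" for x i
  have "expectation (\<lambda>\<omega>. H (\<lambda>a. (\<lambda>(k, t). J k t) a \<omega>) ((\<lambda>(k, t). J k t) (Suc k, Suc t) \<omega>))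
      = expectation (\<lambda>\<omega>. \<Sum>i\<in>UNIV. p i * H (\<lambda>a. (\<lambda>(k, t). J k t) a \<omega>) i)"
  proof (rule expectation_fresh_index[OF indep])
    show "finite (history k t)" "history k t \<subseteq> {1..} \<times> {1..m}"
      using assms history_subset by simp_all
    show "(Suc k, Suc t) \<in> {1..} \<times> {1..m}" "(Suc k, Suc t) \<notin> history k t"
      using assms by (auto simp: history_def)
    show "prob {\<omega> \<in> space P. (\<lambda>(k, t). J k t) (Suc k, Suc t) \<omega> = i} = p i" for i
      using assms prob_J[of "Suc k" "Suc t" i] by simp
    show "H x i = H z i" if "\<And>a. a \<in> history k t \<Longrightarrow> x a = z a" for x z i
      unfolding H_def
      by (rule arg_cong2[where f = "\<lambda>y w.
            F y (closest_point W (w - \<eta> *\<^sub>R vrpsg_direction f fc p y w i))",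
          OF iterates_depend_on_history[OF less_imp_le[OF assms] that]])
  qed
  then show ?thesis
    by (simp add: H_def curry_def Let_def)
qed

lemma inner_step_expectation:
  fixes k t :: nat
  assumes "t < m"
  defines "D \<equiv> \<lambda>t. expectation (\<lambda>\<omega>. (norm (inner_iterate (draws \<omega>) k t - opt (outer (draws \<omega>) k)))\<^sup>2)"
    and "G \<equiv> \<lambda>t. expectation (\<lambda>\<omega>. f (inner_iterate (draws \<omega>) k t) - fopt)"
  shows "D (Suc t) + 2 * \<eta> * G (Suc t) \<le> D t + 8 * \<eta>\<^sup>2 * LP * (G t + G 0)"
proof -
  let ?x = "\<lambda>\<omega>. outer (draws \<omega>) k" and ?w = "\<lambda>\<omega>. inner_iterate (draws \<omega>) k"
  define F where "F x w = (norm (w - opt x))\<^sup>2 + 2 * \<eta> * (f w - fopt)" for x w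
  define R where "R x w = (norm (w - opt x))\<^sup>2 + 8 * \<eta>\<^sup>2 * LP * ((f w - fopt) + (f x - fopt))" for x w
  let ?u = "\<lambda>x w i. closest_point W (w - \<eta> *\<^sub>R vrpsg_direction f fc p x w i)"
  have D_int: "integrable P (\<lambda>\<omega>. (norm (?w \<omega> t - opt (?x \<omega>)))\<^sup>2)" if "t \<le> m" for t
    using integrable_iterates[OF that, of "\<lambda>x w. (norm (w - opt x))\<^sup>2"] .
  have G_int: "integrable P (\<lambda>\<omega>. f (?w \<omega> t) - fopt)" if "t \<le> m" for t
    using integrable_iterates[OF that, of "\<lambda>x w. f w - fopt"] .
  have "D (Suc t) + 2 * \<eta> * G (Suc t) = expectation (\<lambda>\<omega>. F (?x \<omega>) (?w \<omega> (Suc t)))"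
    unfolding F_def D_def G_def using D_int[of "Suc t"] G_int[of "Suc t"] assms(1)
    by (simp del: vrpsg_inner.simps)
  also have "\<dots> = expectation (\<lambda>\<omega>. \<Sum>i\<in>UNIV. p i * F (?x \<omega>) (?u (?x \<omega>) (?w \<omega> t) i))"
    by (rule expectation_inner_Suc[OF assms(1)])
  also have "\<dots> \<le> expectation (\<lambda>\<omega>. R (?x \<omega>) (?w \<omega> t))"
  proof (rule integral_mono)
    show "integrable P (\<lambda>\<omega>. \<Sum>i\<in>UNIV. p i * F (?x \<omega>) (?u (?x \<omega>) (?w \<omega> t) i))"
      using integrable_iterates[of t "\<lambda>x w. \<Sum>i\<in>UNIV. p i * F x (?u x w i)"] assms(1) by simp
    show "integrable P (\<lambda>\<omega>. R (?x \<omega>) (?w \<omega> t))"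
      using integrable_iterates[of t R] assms(1) by simp
    show "(\<Sum>i\<in>UNIV. p i * F (?x \<omega>) (?u (?x \<omega>) (?w \<omega> t) i)) \<le> R (?x \<omega>) (?w \<omega> t)" for \<omega>
      using expected_projected_step[OF W opt(1) inner_in_W[OF outer_in_W] outer_in_W _ \<eta>(1) \<eta>_LP,
          of "?x \<omega>" "draws \<omega>" k "draws \<omega> (Suc k)" t "draws \<omega>" k] fopt_le
      unfolding F_def R_def opt(2) by blast
  qed
  also have "\<dots> = D t + 8 * \<eta>\<^sup>2 * LP * (G t + G 0)"
  proof -
    have linear: "expectation (\<lambda>\<omega>. a \<omega> + K * (b \<omega> + c \<omega>))
        = expectation a + K * (expectation b + expectation c)"
      if "integrable P a" "integrable P b" "integrable P c" for a b c :: "'w \<Rightarrow> real" and K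
      using that by simp
    show ?thesis
      unfolding R_def D_def G_def
      using linear[OF D_int[of t] G_int[of t] G_int[of 0]] assms(1) by simp
  qed
  finally show ?thesis .
qed

text \<open>After telescoping, the last distance is dropped as non-negative and the assumed growth bound
  turns the first one into \<open>c\<close> times the gap at the reference point. Of the terms with \<open>\<eta>\<^sup>2\<close>, those from inside
  the loop are absorbed on the left, which produces the factor \<open>1 - 4 * LP * \<eta>\<close>.\<close>

lemma outer_step_expectation:
  fixes k :: nat
  assumes growth: "\<And>\<omega>. \<omega> \<in> space P \<Longrightarrow> (norm (outer (draws \<omega>) k - opt (outer (draws \<omega>) k)))\<^sup>2
      \<le> c * (f (outer (draws \<omega>) k) - fopt)"
  defines "gap \<equiv> \<lambda>k. expectation (\<lambda>\<omega>. f (outer (draws \<omega>) k) - fopt)"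
  shows "2 * \<eta> * (1 - 4 * LP * \<eta>) * (of_nat m * gap (Suc k))
    \<le> (c + 8 * \<eta>\<^sup>2 * LP * (of_nat m + 1)) * gap k"
proof -
  let ?x = "\<lambda>\<omega>. outer (draws \<omega>) k" and ?w = "\<lambda>\<omega>. inner_iterate (draws \<omega>) k"
  define D where "D t = expectation (\<lambda>\<omega>. (norm (?w \<omega> t - opt (?x \<omega>)))\<^sup>2)" for t
  define G where "G t = expectation (\<lambda>\<omega>. f (?w \<omega> t) - fopt)" for t
  have G_int: "integrable P (\<lambda>\<omega>. f (?w \<omega> t) - fopt)" if "t \<le> m" for t
    using integrable_iterates[OF that, of "\<lambda>x w. f w - fopt"] .
  have G_nonneg: "0 \<le> G t" for t
    unfolding G_def using fopt_le inner_in_W[OF outer_in_W]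
    by (intro Bochner_Integration.integral_nonneg) simp
  have D_nonneg: "0 \<le> D t" for t
    unfolding D_def by simp
  have "D t + 2 * \<eta> * (\<Sum>s\<in>{1..t}. G s) \<le> D 0 + 8 * \<eta>\<^sup>2 * LP * ((\<Sum>s<t. G s) + of_nat t * G 0)"
    if "t \<le> m" for t
    using that
  proof (induction t)
    case (Suc t)
    then have "D (Suc t) + 2 * \<eta> * G (Suc t) \<le> D t + 8 * \<eta>\<^sup>2 * LP * (G t + G 0)"
      unfolding D_def G_def by (intro inner_step_expectation) simp
    with Suc show ?case
      by (simp add: distrib_left distrib_right)
  qed simp
  from this[of m] have "2 * \<eta> * (\<Sum>s\<in>{1..m}. G s)
      \<le> D 0 + 8 * \<eta>\<^sup>2 * LP * ((\<Sum>s<m. G s) + of_nat m * G 0)"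
    using D_nonneg[of m] by simp
  also have "\<dots> \<le> c * G 0 + 8 * \<eta>\<^sup>2 * LP * ((G 0 + (\<Sum>s\<in>{1..m}. G s)) + of_nat m * G 0)"
  proof (intro add_mono mult_left_mono order_refl)
    have "D 0 \<le> expectation (\<lambda>\<omega>. c * (f (?w \<omega> 0) - fopt))"
      unfolding D_def
    proof (rule integral_mono)
      show "integrable P (\<lambda>\<omega>. (norm (?w \<omega> 0 - opt (?x \<omega>)))\<^sup>2)"
        using integrable_iterates[of 0 "\<lambda>x w. (norm (w - opt x))\<^sup>2"] by simp
      show "integrable P (\<lambda>\<omega>. c * (f (?w \<omega> 0) - fopt))"
        using G_int[of 0] by simp
    qed (use growth in simp)
    then show "D 0 \<le> c * G 0"
      by (simp add: G_def)
    \<comment> \<open>Adding the non-negative last gap lets the sum over the starting points of the steps be absorbed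
      by the sum over their end points on the left-hand side.\<close>
    have "(\<Sum>s<m. G s) \<le> (\<Sum>s\<in>{0..m}. G s)"
      using G_nonneg by (intro sum_mono2) auto
    also have "\<dots> = G 0 + (\<Sum>s\<in>{1..m}. G s)"
      by (simp add: sum.atLeast_Suc_atMost)
    finally show "(\<Sum>s<m. G s) \<le> G 0 + (\<Sum>s\<in>{1..m}. G s)" .
  qed (use LP_pos in \<open>simp_all add: zero_le_mult_iff\<close>)
  finally have "2 * \<eta> * (1 - 4 * LP * \<eta>) * (\<Sum>s\<in>{1..m}. G s)
      \<le> (c + 8 * \<eta>\<^sup>2 * LP * (of_nat m + 1)) * G 0"
    by (simp add: power2_eq_square algebra_simps)
  moreover have "of_nat m * gap (Suc k) \<le> (\<Sum>s\<in>{1..m}. G s)"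
  proof -
    have "gap (Suc k) \<le> expectation (\<lambda>\<omega>. (1 / of_nat m) * (\<Sum>t\<in>{1..m}. f (?w \<omega> t) - fopt))"
      unfolding gap_def
    proof (rule integral_mono)
      show "integrable P (\<lambda>\<omega>. f (outer (draws \<omega>) (Suc k)) - fopt)"
        using integrable_iterates[of 0 "\<lambda>x w. f x - fopt" "Suc k"] by simp
      show "integrable P (\<lambda>\<omega>. (1 / of_nat m) * (\<Sum>t\<in>{1..m}. f (?w \<omega> t) - fopt))"
        using G_int by (intro integrable_mult_right Bochner_Integration.integrable_sum) auto
    qed (rule outer_gap_le_mean)
    also have "\<dots> = (1 / of_nat m) * (\<Sum>s\<in>{1..m}. G s)"
      unfolding integral_mult_right_zero G_def
      by (subst Bochner_Integration.integral_sum) (use G_int in auto)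
    finally show ?thesis
      using m by (simp add: field_simps)
  qed
  then have "2 * \<eta> * (1 - 4 * LP * \<eta>) * (of_nat m * gap (Suc k))
      \<le> 2 * \<eta> * (1 - 4 * LP * \<eta>) * (\<Sum>s\<in>{1..m}. G s)"
    using \<eta> by (intro mult_left_mono) auto
  moreover have "gap k = G 0"
    by (simp add: gap_def G_def)
  ultimately show ?thesis
    by simp
qed

end

section \<open>Linear convergence\<close>

theorem theorem1:
  fixes X :: "real ^ 'd ^ 'n" and q :: "real ^ 'd"
    and h :: "real ^ 'n \<Rightarrow> real" and D :: "(real ^ 'n) set"
    and f :: "real ^ 'd \<Rightarrow> real" and fc :: "'n \<Rightarrow> real ^ 'd \<Rightarrow> real"
    and L :: real and Lc :: "'n \<Rightarrow> real"
    and C :: "real ^ 'd ^ 'l" and b :: "real ^ 'l"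
    and W Wopt B :: "(real ^ 'd) set" and fopt :: real
    and p :: "'n \<Rightarrow> real" and L\<^sub>P \<eta> \<mu> \<theta> M \<beta> \<rho> s :: real
    and r :: "real ^ 'n" and U :: "(real ^ 'n) set"
    and m :: nat and w0 :: "real ^ 'd"
    and P :: "'w measure" and J :: "nat \<Rightarrow> nat \<Rightarrow> 'w \<Rightarrow> 'n"
  assumes f_eq: "f = (\<lambda>w. h (X *v w) + q \<bullet> w)"
    and X_dom: "\<And>w. X *v w \<in> D"
    and A1_avg: "\<And>w. f w = (1 / of_nat CARD('n)) * (\<Sum>i\<in>UNIV. fc i w)"
    and A1_convex: "\<And>i. convex_on UNIV (fc i)"
    and A1_diff: "\<And>i w. fc i differentiable (at w)"
    and A1_L: "L > 0" "L-lipschitz_on UNIV (grad f)"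
    and A1_Lc: "\<And>i. Lc i > 0" "\<And>i. (Lc i)-lipschitz_on UNIV (grad (fc i))"
    and A2_dom: "open D" "D \<noteq> {}"
    and A2_C1: "continuously_diff_on h D"
    and A2_strong: "\<And>V. convex V \<Longrightarrow> compact V \<Longrightarrow> V \<subseteq> D \<Longrightarrow> \<exists>\<nu>. strongly_convex_on \<nu> V h"
    and A3_W: "W = {w. C *v w \<le> b}"
    and A3_Wopt: "Wopt = {w. is_arg_min f (\<lambda>v. v \<in> W) w}" "Wopt \<noteq> {}"
    and fopt: "fopt = Inf (f ` W)"
    and p: "\<And>i. 0 < p i" "\<And>i. p i < 1" "(\<Sum>i\<in>UNIV. p i) = 1"
    and L\<^sub>P: "L\<^sub>P = Max (range (\<lambda>i. Lc i / (of_nat CARD('n) * p i)))"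
    and \<eta>: "0 < \<eta>" "\<eta> < 1 / (4 * L\<^sub>P)"
    and m: "m \<ge> 1"
    and w0: "w0 \<in> W"
    and J: "random_indices P p m J"
    and B: "bounded B" "convex B" "B \<subseteq> W"
    and iterates_B: "\<And>\<omega> k t. \<omega> \<in> space P \<Longrightarrow> k \<ge> 1 \<Longrightarrow> t \<le> m \<Longrightarrow>
          vrpsg_iterate f fc W p \<eta> m w0 (\<lambda>k t. J k t \<omega>) k t \<in> B"
    and rs: "\<And>w. w \<in> Wopt \<Longrightarrow> X *v w = r" "\<And>w. w \<in> Wopt \<Longrightarrow> q \<bullet> w = s"
    and M: "M > 0" "\<And>w. w \<in> B \<Longrightarrow> f w - fopt \<le> M"
    and U: "convex U" "compact U" "U \<subseteq> D" "r \<in> U" "\<And>w. w \<in> B \<Longrightarrow> X *v w \<in> U"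
    and \<mu>: "strongly_convex_on \<mu> U h"
    and \<theta>: "hoffman_constant \<theta> Wopt C b X r q s"
    and \<beta>: "\<beta> = 1 / (\<theta>\<^sup>2 * ((1 + 2 * (norm (grad h r))\<^sup>2) / \<mu> + M))"
    and \<rho>: "\<rho> = 4 * L\<^sub>P * \<eta> * (of_nat m + 1) / ((1 - 4 * L\<^sub>P * \<eta>) * of_nat m)
                + 1 / (\<beta> * \<eta> * (1 - 4 * L\<^sub>P * \<eta>) * of_nat m)"
    and \<rho>_less: "\<rho> < 1"
  shows "\<forall>k\<ge>1. (\<integral>\<omega>. (f (vrpsg_outer f fc W p \<eta> m w0 (\<lambda>k t. J k t \<omega>) k) - fopt) \<partial>P)
                  \<le> \<rho> ^ k * (f w0 - fopt)"
proof -
  interpret prob_space P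
    using J unfolding random_indices_def by blast
  define N where "N = (of_nat CARD('n) :: real)"
  have N: "N > 0"
    by (simp add: N_def)
  have Lc_le: "Lc i \<le> L\<^sub>P * (N * p i)" for i
  proof -
    have "Lc i / (N * p i) \<le> L\<^sub>P"
      unfolding L\<^sub>P N_def by (rule Max_ge) auto
    then show ?thesis
      using N p(1)[of i] by (simp add: pos_divide_le_eq)
  qed
  interpret weighted_finite_sum f fc Lc p L\<^sub>P
    using A1_avg A1_convex A1_diff A1_Lc p Lc_le unfolding N_def by unfold_locales auto
  have step: "4 * L\<^sub>P * \<eta> < 1"
    using \<eta> LP_pos by (simp add: pos_less_divide_eq mult_ac)
  obtain v\<^sub>0 where v0: "v\<^sub>0 \<in> Wopt"
    using A3_Wopt by blast
  have Wopt: "v \<in> W" "\<And>w. w \<in> W \<Longrightarrow> f v \<le> f w" if "v \<in> Wopt" for v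
    using that unfolding A3_Wopt is_arg_min_def by (auto simp: not_less)
  have fopt_Wopt: "f v = fopt" if "v \<in> Wopt" for v
    unfolding fopt using Wopt[OF that] by (intro cInf_eq_minimum[symmetric]) auto
  have fopt_rs: "fopt = h r + s"
    using fopt_Wopt[OF v0] rs v0 by (simp add: f_eq)
  \<comment> \<open>This is \<open>2 / \<beta>\<close>.\<close>
  define c where "c = 2 * (\<theta>\<^sup>2 * ((1 + 2 * (norm (grad h r))\<^sup>2) / \<mu> + M))"
  have "\<mu> > 0" "\<theta> > 0"
    using \<mu> \<theta> by (simp_all add: strongly_convex_on_def hoffman_constant_def)
  then have "c > 0"
    using M unfolding c_def
    by (intro mult_pos_pos add_nonneg_pos divide_nonneg_pos) auto
  have \<beta>_c: "1 / \<beta> = c / 2"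
    by (simp add: \<beta> c_def)
  have "\<exists>v\<in>Wopt. w \<in> B \<longrightarrow> (norm (w - v))\<^sup>2 \<le> c * (f w - fopt)" for w
  proof (cases "w \<in> B")
    case True
    have "\<exists>v\<in>Wopt. (norm (w - v))\<^sup>2 \<le> c * (f w - (h r + s))"
      unfolding c_def
    proof (rule hoffman_quadratic_growth[OF f_eq _ A3_W Wopt rs \<mu> \<theta> M(1)])
      show "h differentiable (at r)"
        using A2_C1 U(3,4) unfolding continuously_diff_on_def by blast
      show "f w - (h r + s) \<le> M"
        using M(2)[OF True] fopt_rs by simp
    qed (use True B U in auto)
    then show ?thesis
      by (auto simp: fopt_rs)
  qed (use v0 in blast)
  then obtain opt where opt: "\<And>w. opt w \<in> Wopt"
    and opt_dist: "\<And>w. w \<in> B \<Longrightarrow> (norm (w - opt w))\<^sup>2 \<le> c * (f w - fopt)"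
    by metis
  interpret vrpsg_run f fc Lc p L\<^sub>P P W \<eta> fopt m w0 J opt
  proof unfold_locales
    show "convex W" "closed W"
      unfolding A3_W by (rule convex_closed_polyhedron)+
    show "indep_vars (\<lambda>_. count_space UNIV) (\<lambda>(k, t). J k t) ({1..} \<times> {1..m})"
      and "\<And>k t i. 1 \<le> k \<Longrightarrow> t \<in> {1..m} \<Longrightarrow> prob {\<omega> \<in> space P. J k t \<omega> = i} = p i"
      using J unfolding random_indices_def by blast+
    show "fopt \<le> f z" if "z \<in> W" for z
      using Wopt(2)[OF v0 that] fopt_Wopt[OF v0] by simp
  qed (use opt Wopt fopt_Wopt w0 m \<eta> step in auto)
  define gap where "gap k = expectation (\<lambda>\<omega>. f (outer (draws \<omega>) k) - fopt)" for k
  have contraction: "gap (Suc k) \<le> \<rho> * gap k" for k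
  proof -
    \<comment> \<open>The reference point is the iterate with inner index \<open>0\<close>, hence covered by the bound on \<open>B\<close>.\<close>
    have "outer (draws \<omega>) k \<in> B" if "\<omega> \<in> space P" for \<omega>
      using iterates_B[OF that, of "Suc k" 0] by (simp add: vrpsg_iterate_def)
    then have *: "2 * \<eta> * (1 - 4 * L\<^sub>P * \<eta>) * (of_nat m * gap (Suc k))
        \<le> (c + 8 * \<eta>\<^sup>2 * L\<^sub>P * (of_nat m + 1)) * gap k"
      unfolding gap_def by (intro outer_step_expectation opt_dist)
    define d where "d = 1 - 4 * L\<^sub>P * \<eta>"
    have d: "d > 0" and m': "real m > 0"
      using step m by (auto simp: d_def)
    have "\<rho> = (c + 8 * \<eta>\<^sup>2 * L\<^sub>P * (of_nat m + 1)) / (2 * \<eta> * d * of_nat m)"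
    proof -
      have "\<rho> = 4 * L\<^sub>P * \<eta> * (of_nat m + 1) / (d * of_nat m) + (1 / \<beta>) / (\<eta> * d * of_nat m)"
        by (simp add: \<rho> d_def mult.assoc)
      then show ?thesis
        unfolding \<beta>_c using d m' \<eta>(1) by (simp add: field_simps power2_eq_square)
    qed
    then show ?thesis
      using * d m' \<eta>(1) unfolding d_def[symmetric] by (simp add: pos_le_divide_eq mult_ac)
  qed
  have "\<rho> \<ge> 0"
  proof -
    have "1 / \<beta> > 0"
      using \<open>c > 0\<close> by (simp add: \<beta>_c)
    then have "\<beta> > 0"
      by simp
    then show ?thesis
      unfolding \<rho> using LP_pos \<eta>(1) step
      by (intro add_nonneg_nonneg divide_nonneg_nonneg mult_nonneg_nonneg) auto
  qed
  have "gap k \<le> \<rho> ^ k * (f w0 - fopt)" for k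
  proof (induction k)
    case 0
    show ?case
      by (simp add: gap_def prob_space)
  next
    case (Suc k)
    have "gap (Suc k) \<le> \<rho> * gap k"
      by (rule contraction)
    also have "\<dots> \<le> \<rho> * (\<rho> ^ k * (f w0 - fopt))"
      using Suc \<open>\<rho> \<ge> 0\<close> by (rule mult_left_mono)
    finally show ?case
      by (simp add: mult.assoc)
  qed
  then show ?thesis
    by (simp add: gap_def)
qed

end
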